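(* For a fixed channel $P_{Y|X}$, Lautum information $L(X;Y)$ is not concave with respect to the input distribution $P_X$.
   Context: Let $X$ and $Y$ be random variables taking values in spaces $\mathcal{X}$ and $\mathcal{Y}$. A channel $P_{Y|X}$ from $\mathcal{X}$ to $\mathcal{Y}$ is a conditional distribution of $Y$ given $X$, assigning to each $x\in\mathcal{X}$ a probability distribution $P_{Y|X=x}$ on $\mathcal{Y}$. Given an input distribution $P_X$ on $\mathcal{X}$, the joint distribution $P_{XY}$ is the one induced by $P_X$ and $P_{Y|X}$, and $P_Y=\int P_{Y|X=x}\,dP_X(x)$ is the corresponding marginal distribution of the output $Y$. The Kullback-Leibler divergence between two probability measures $P$ and $Q$ over a space $\mathcal{Z}$, where $P$ is absolutely continuous with respect to $Q$, is $D(P\|Q)=\int_{\mathcal{Z}}P(z)\log\frac{P(z)}{Q(z)}\,dz$ (a sum in the discrete case). The Lautum information between $X$ and $Y$ is $L(X;Y)=D(P_XP_Y\|P_{XY})$, where $P_XP_Y$ denotes the product of the marginal distributions. With $P_{Y|X}$ held fixed, $L(X;Y)$ is regarded as a function of the input distribution $P_X$. Such a function $F$ is concave with respect to $P_X$ if $F((1-\alpha)P_{X_0}+\alpha P_{X_1})\ge(1-\alpha)F(P_{X_0})+\alpha F(P_{X_1})$ for all input distributions $P_{X_0},P_{X_1}$ and all $\alpha\in[0,1]$. *)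

theory Defs
  imports "HOL-Probability.Probability"
begin

abbreviation input_dists :: "'a measure \<Rightarrow> 'a measure set" where
  "input_dists \<X> \<equiv> space (prob_algebra \<X>)"

abbreviation channels :: "'a measure \<Rightarrow> 'b measure \<Rightarrow> ('a \<Rightarrow> 'b measure) set" where
  "channels \<X> \<Y> \<equiv> \<X> \<rightarrow>\<^sub>M prob_algebra \<Y>"

definition joint_dist ::
  "'a measure \<Rightarrow> 'b measure \<Rightarrow> ('a \<Rightarrow> 'b measure) \<Rightarrow> 'a measure \<Rightarrow> ('a \<times> 'b) measure" where
  "joint_dist \<X> \<Y> W P = P \<bind> (\<lambda>x. W x \<bind> (\<lambda>y. return (\<X> \<Otimes>\<^sub>M \<Y>) (x, y)))"

definition output_dist :: "('a \<Rightarrow> 'b measure) \<Rightarrow> 'a measure \<Rightarrow> 'b measure" where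
  "output_dist W P = P \<bind> W"

definition marginal_product ::
  "('a \<Rightarrow> 'b measure) \<Rightarrow> 'a measure \<Rightarrow> ('a \<times> 'b) measure" where
  "marginal_product W P = P \<Otimes>\<^sub>M output_dist W P"

text \<open>
  The arguments of \<^const>\<open>KL_divergence\<close> are reversed with respect to the usual notation:
  \<^term>\<open>KL_divergence b M N\<close> is the divergence D(N || M).
\<close>

definition lautum_information ::
  "real \<Rightarrow> 'a measure \<Rightarrow> 'b measure \<Rightarrow> ('a \<Rightarrow> 'b measure) \<Rightarrow> 'a measure \<Rightarrow> real" where
  "lautum_information b \<X> \<Y> W P =
     KL_divergence b (joint_dist \<X> \<Y> W P) (marginal_product W P)"

text \<open>
  \<^const>\<open>KL_divergence\<close> is a total real-valued function whose value is meaningless when absolute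
  continuity fails, and is 0 when the divergence is infinite. The following predicate says that
  neither happens.
\<close>

definition lautum_well_defined ::
  "real \<Rightarrow> 'a measure \<Rightarrow> 'b measure \<Rightarrow> ('a \<Rightarrow> 'b measure) \<Rightarrow> 'a measure \<Rightarrow> bool" where
  "lautum_well_defined b \<X> \<Y> W P \<longleftrightarrow>
     absolutely_continuous (joint_dist \<X> \<Y> W P) (marginal_product W P) \<and>
     integrable (marginal_product W P)
       (entropy_density b (joint_dist \<X> \<Y> W P) (marginal_product W P))"

definition mixture :: "real \<Rightarrow> 'a measure \<Rightarrow> 'a measure \<Rightarrow> 'a measure" where
  "mixture \<alpha> P0 P1 =
     measure_of (space P0) (sets P0)
       (\<lambda>A. ennreal (1 - \<alpha>) * emeasure P0 A + ennreal \<alpha> * emeasure P1 A)"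

definition concave_in_input :: "'a measure \<Rightarrow> ('a measure \<Rightarrow> real) \<Rightarrow> bool" where
  "concave_in_input \<X> F \<longleftrightarrow>
     (\<forall>P0 \<in> input_dists \<X>. \<forall>P1 \<in> input_dists \<X>. \<forall>\<alpha> \<in> {0..1}.
        F (mixture \<alpha> P0 P1) \<ge> (1 - \<alpha>) * F P0 + \<alpha> * F P1)"

lemma space_mixture [simp]: "space (mixture \<alpha> P0 P1) = space P0"
  and sets_mixture [simp]: "sets (mixture \<alpha> P0 P1) = sets P0"
  by (simp_all add: mixture_def)

lemma emeasure_mixture:
  assumes "sets P1 = sets P0" and "A \<in> sets P0"
  shows "emeasure (mixture \<alpha> P0 P1) A
         = ennreal (1 - \<alpha>) * emeasure P0 A + ennreal \<alpha> * emeasure P1 A"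
proof (rule emeasure_measure_of[OF mixture_def])
  show "sets P0 \<subseteq> Pow (space P0)" by (rule sets.space_closed)
  show "A \<in> sets (mixture \<alpha> P0 P1)" using assms by simp
  show "positive (sets (mixture \<alpha> P0 P1))
          (\<lambda>A. ennreal (1 - \<alpha>) * emeasure P0 A + ennreal \<alpha> * emeasure P1 A)"
    by (simp add: positive_def)
  show "countably_additive (sets (mixture \<alpha> P0 P1))
          (\<lambda>A. ennreal (1 - \<alpha>) * emeasure P0 A + ennreal \<alpha> * emeasure P1 A)"
    unfolding countably_additive_def sets_mixture
  proof (intro allI impI)
    fix B :: "nat \<Rightarrow> _" assume B: "range B \<subseteq> sets P0" "disjoint_family B"
    have "(\<Sum>i. emeasure P0 (B i)) = emeasure P0 (\<Union>i. B i)"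
      using B by (rule suminf_emeasure)
    moreover have "(\<Sum>i. emeasure P1 (B i)) = emeasure P1 (\<Union>i. B i)"
      using B assms(1) by (intro suminf_emeasure) auto
    ultimately show "(\<Sum>i. ennreal (1 - \<alpha>) * emeasure P0 (B i) + ennreal \<alpha> * emeasure P1 (B i))
        = ennreal (1 - \<alpha>) * emeasure P0 (\<Union> (range B)) + ennreal \<alpha> * emeasure P1 (\<Union> (range B))"
      by (simp add: suminf_add[symmetric])
  qed
qed

lemma mixture_in_input_dists:
  assumes "P0 \<in> input_dists \<X>" "P1 \<in> input_dists \<X>" "\<alpha> \<in> {0..1}"
  shows "mixture \<alpha> P0 P1 \<in> input_dists \<X>"
proof -
  have P: "prob_space P0" "prob_space P1" "sets P0 = sets \<X>" "sets P1 = sets P0"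
    using assms by (auto simp: space_prob_algebra)
  have "space P0 \<in> sets P0" "emeasure P0 (space P0) = 1" "emeasure P1 (space P0) = 1"
    using P(1,2)[THEN prob_space.emeasure_space_1] sets_eq_imp_space_eq[OF P(4)] by auto
  then have "emeasure (mixture \<alpha> P0 P1) (space P0) = ennreal (1 - \<alpha>) + ennreal \<alpha>"
    by (simp add: emeasure_mixture[OF P(4)])
  also have "\<dots> = 1"
    using assms(3) by (simp flip: ennreal_plus)
  finally have "prob_space (mixture \<alpha> P0 P1)"
    by (intro prob_spaceI) simp
  with P show ?thesis
    by (simp add: space_prob_algebra)
qed

end

theory Submission
  imports Defs
begin

text \<open>
  The channel has two inputs and two outputs, with rows \<open>(25/26, 1/26)\<close> and \<open>(1/2, 1/2)\<close>. Let
  \<open>L p\<close> be its Lautum information when the second input has probability \<open>p\<close>. With the output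
  law \<open>Q = (1 - p) W\<^sub>0 + p W\<^sub>1\<close>, up to an affine term in \<open>p\<close>, \<open>L p\<close> is the negative entropy of
  \<open>Q\<close>, which is convex, minus \<open>p\<^sup>2\<close> times the symmetrised divergence of the rows. Near \<open>p = 0\<close> the
  second derivative of the former is of the order of \<open>1/\<epsilon>\<close> for a row \<open>(1 - \<epsilon>, \<epsilon>)\<close>, that of the
  latter only of the order of \<open>log (1/\<epsilon>)\<close>, so convexity wins for small \<open>\<epsilon>\<close> and \<open>p\<close>. Here
  \<open>\<epsilon> = 1/26\<close>, and \<open>2 L(1/12) < L 0 + L(1/6)\<close> amounts to \<open>2^444 * 3^135 < 5^149 * 23^69\<close>.
\<close>

section \<open>Divergence and Lautum information on finite spaces\<close>

lemma (in finite_measure) eq_point_measure: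
  assumes "finite A" and "sets M = Pow A"
  shows "M = point_measure A (\<lambda>a. ennreal (measure M {a}))"
  using assms
  by (intro measure_eqI_finite[of _ A])
     (auto simp: sets_point_measure emeasure_point_measure_finite emeasure_eq_measure)

text \<open>Both measures are densities over \<open>count_space A\<close>, so
  \<open>KL_density_density\<close> applies. The last assumption is absolute continuity; as the
  arguments of \<open>KL_divergence\<close> are reversed, \<open>g\<close> is the law averaged
  over.\<close>

lemma KL_divergence_point_measure:
  fixes f g :: "'a \<Rightarrow> real"
  assumes "1 < b" "finite A"
    and "\<And>a. a \<in> A \<Longrightarrow> 0 \<le> f a" "\<And>a. a \<in> A \<Longrightarrow> 0 \<le> g a"
    and "\<And>a. a \<in> A \<Longrightarrow> f a = 0 \<Longrightarrow> g a = 0"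
  shows "KL_divergence b (point_measure A f) (point_measure A g)
         = (\<Sum>a\<in>A. g a * log b (g a / f a))"
proof -
  interpret sigma_finite_measure "count_space A"
    using assms(2) by (intro sigma_finite_measure_count_space_finite)
  show ?thesis
    unfolding point_measure_def using assms
    by (subst KL_density_density)
       (auto simp: AE_count_space lebesgue_integral_count_space_finite)
qed

text \<open>The indicator of a rectangle factors, so the inner integral against \<open>W x\<close>
  leaves only the mass of \<open>B\<close>. Applied to singletons, this gives the point masses of
  the joint law.\<close>

lemma emeasure_joint_dist:
  assumes P: "P \<in> input_dists \<X>" and W: "W \<in> channels \<X> \<Y>"
    and A: "A \<in> sets \<X>" and B: "B \<in> sets \<Y>"
  shows "emeasure (joint_dist \<X> \<Y> W P) (A \<times> B)
         = (\<integral>\<^sup>+x. indicator A x * emeasure (W x) B \<partial>P)"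
proof -
  have AB: "A \<times> B \<in> sets (\<X> \<Otimes>\<^sub>M \<Y>)"
    using A B by simp
  have space_P: "space P = space \<X>"
    using P by (intro sets_eq_imp_space_eq) (simp add: space_prob_algebra)
  have kernel: "(\<lambda>x. W x \<bind> (\<lambda>y. return (\<X> \<Otimes>\<^sub>M \<Y>) (x, y))) \<in> \<X> \<rightarrow>\<^sub>M prob_algebra (\<X> \<Otimes>\<^sub>M \<Y>)"
    using W by measurable
  have "emeasure (W x \<bind> (\<lambda>y. return (\<X> \<Otimes>\<^sub>M \<Y>) (x, y))) (A \<times> B)
        = indicator A x * emeasure (W x) B" if x: "x \<in> space \<X>" for x
  proof -
    have Wx: "W x \<in> space (prob_algebra \<Y>)"
      using measurable_space[OF W x] .
    then have B': "B \<in> sets (W x)"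
      using B by (simp add: space_prob_algebra)
    have ret: "(\<lambda>y. return (\<X> \<Otimes>\<^sub>M \<Y>) (x, y)) \<in> \<Y> \<rightarrow>\<^sub>M prob_algebra (\<X> \<Otimes>\<^sub>M \<Y>)"
      using x by measurable
    have "emeasure (W x \<bind> (\<lambda>y. return (\<X> \<Otimes>\<^sub>M \<Y>) (x, y))) (A \<times> B)
          = (\<integral>\<^sup>+y. emeasure (return (\<X> \<Otimes>\<^sub>M \<Y>) (x, y)) (A \<times> B) \<partial>W x)"
      by (rule emeasure_bind_prob_algebra[OF Wx ret AB])
    also have "\<dots> = (\<integral>\<^sup>+y. indicator A x * indicator B y \<partial>W x)"
      using AB by (intro nn_integral_cong) (simp add: indicator_times)
    also have "\<dots> = indicator A x * emeasure (W x) B"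
      using B' by (rule nn_integral_cmult_indicator)
    finally show ?thesis .
  qed
  then show ?thesis
    unfolding joint_dist_def emeasure_bind_prob_algebra[OF P kernel AB]
    by (intro nn_integral_cong) (simp add: space_P)
qed

text \<open>Since the rows are strictly positive, a joint mass vanishes only where the input mass
  does, and there the product mass vanishes too. This gives absolute continuity even for inputs
  without full support; integrability is automatic on a finite space.\<close>

lemma lautum_finite:
  fixes A :: "'a set" and B :: "'b set" and b :: real
  defines "\<X> \<equiv> count_space A" and "\<Y> \<equiv> count_space B"
  assumes b: "1 < b" and fin: "finite A" "finite B"
    and W: "W \<in> channels \<X> \<Y>" and P: "P \<in> input_dists \<X>"
    and pos: "\<And>x y. x \<in> A \<Longrightarrow> y \<in> B \<Longrightarrow> 0 < measure (W x) {y}"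
  defines "q \<equiv> \<lambda>y. \<Sum>x\<in>A. measure P {x} * measure (W x) {y}"
  shows "lautum_well_defined b \<X> \<Y> W P" (is ?wd)
    and "lautum_information b \<X> \<Y> W P
         = (\<Sum>x\<in>A. \<Sum>y\<in>B. measure P {x} * q y * log b (q y / measure (W x) {y}))" (is ?L)
proof -
  define J where "J = joint_dist \<X> \<Y> W P"
  define Q where "Q = output_dist W P"
  define M where "M = marginal_product W P"
  let ?p = "\<lambda>x. measure P {x}" and ?w = "\<lambda>x y. measure (W x) {y}"
  have sets_XY: "sets (\<X> \<Otimes>\<^sub>M \<Y>) = Pow (A \<times> B)"
    unfolding \<X>_def \<Y>_def pair_measure_count_space[OF fin] by simp
  have P_prob: "prob_space P" and sets_P: "sets P = Pow A"
    using P by (auto simp: space_prob_algebra \<X>_def)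
  have Q_prob: "prob_space Q" and sets_Q: "sets Q = Pow B"
    using prob_space_bind'[OF P W] sets_bind'[OF P W]
    by (auto simp: Q_def output_dist_def \<Y>_def)
  interpret P: prob_space P by fact
  interpret Q: prob_space Q by fact
  have W_prob: "prob_space (W x)" if "x \<in> A" for x
    using measurable_space[OF W, of x] that by (auto simp: space_prob_algebra \<X>_def)
  note emeasure_W = finite_measure.emeasure_eq_measure[OF prob_space.finite_measure[OF W_prob]]
  have kernel: "(\<lambda>x. W x \<bind> (\<lambda>y. return (\<X> \<Otimes>\<^sub>M \<Y>) (x, y))) \<in> \<X> \<rightarrow>\<^sub>M prob_algebra (\<X> \<Otimes>\<^sub>M \<Y>)"
    using W by measurable
  have J_prob: "prob_space J" and sets_J: "sets J = Pow (A \<times> B)"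
    using prob_space_bind'[OF P kernel] sets_bind'[OF P kernel] sets_XY
    by (auto simp: J_def joint_dist_def)
  interpret J: prob_space J by fact

  have P_point: "P = point_measure A ?p"
    using fin(1) sets_P by (rule P.eq_point_measure)
  have nn_P: "(\<integral>\<^sup>+x. h x \<partial>P) = (\<Sum>x\<in>A. ennreal (?p x) * h x)" for h
    by (subst P_point) (simp add: nn_integral_point_measure_finite fin mult.commute)

  have Q_y: "measure Q {y} = q y" if y: "y \<in> B" for y
  proof -
    have "emeasure Q {y} = (\<integral>\<^sup>+x. emeasure (W x) {y} \<partial>P)"
      unfolding Q_def output_dist_def
      using y by (intro emeasure_bind_prob_algebra[OF P W]) (simp add: \<Y>_def)
    also have "\<dots> = (\<Sum>x\<in>A. ennreal (?p x * ?w x y))"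
      by (simp add: nn_P emeasure_W ennreal_mult)
    also have "\<dots> = ennreal (q y)"
      by (simp add: q_def)
    finally show ?thesis
      by (simp add: Q.emeasure_eq_measure q_def sum_nonneg)
  qed

  have "emeasure J {(x, y)} = ennreal (?p x * ?w x y)" if "x \<in> A" "y \<in> B" for x y
  proof -
    have "emeasure J ({x} \<times> {y}) = (\<integral>\<^sup>+x'. indicator {x} x' * emeasure (W x') {y} \<partial>P)"
      unfolding J_def using that
      by (intro emeasure_joint_dist[OF P W]) (auto simp: \<X>_def \<Y>_def)
    also have "\<dots> = (\<Sum>x'\<in>A. if x' = x then ennreal (?p x) * emeasure (W x) {y} else 0)"
      unfolding nn_P by (intro sum.cong) auto
    also have "\<dots> = ennreal (?p x * ?w x y)"
      using that fin by (simp add: emeasure_W ennreal_mult)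
    finally show ?thesis by simp
  qed
  then have "measure J {z} = ?p (fst z) * ?w (fst z) (snd z)" if "z \<in> A \<times> B" for z
    using that by (auto simp: measure_def)
  then have J_point: "J = point_measure (A \<times> B) (\<lambda>z. ?p (fst z) * ?w (fst z) (snd z))"
    by (subst J.eq_point_measure[OF _ sets_J])
       (auto simp: fin intro!: measure_eqI_finite[of _ "A \<times> B"]
         simp: sets_point_measure emeasure_point_measure_finite)

  have M_point: "M = point_measure (A \<times> B) (\<lambda>z. ?p (fst z) * q (snd z))"
  proof (rule measure_eqI_finite[of _ "A \<times> B"])
    have "sets M = sets (\<X> \<Otimes>\<^sub>M \<Y>)"
      unfolding M_def marginal_product_def
      by (intro sets_pair_measure_cong) (auto simp: sets_P sets_Q Q_def[symmetric] \<X>_def \<Y>_def)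
    then show "sets M = Pow (A \<times> B)"
      by (simp add: sets_XY)
  next
    fix z assume "z \<in> A \<times> B"
    then obtain x y where z: "z = (x, y)" "x \<in> A" "y \<in> B" by auto
    have "emeasure M ({x} \<times> {y}) = emeasure P {x} * emeasure Q {y}"
      unfolding M_def marginal_product_def Q_def[symmetric] using z
      by (intro Q.emeasure_pair_measure_Times) (auto simp: sets_P sets_Q)
    then show "emeasure M {z} = emeasure (point_measure (A \<times> B) (\<lambda>z. ?p (fst z) * q (snd z))) {z}"
      using z fin
      by (simp add: emeasure_point_measure_finite P.emeasure_eq_measure Q.emeasure_eq_measure Q_y
          ennreal_mult' q_def sum_nonneg)
  qed (use fin in \<open>auto simp: sets_point_measure\<close>)

  have q_nonneg: "0 \<le> q y" for y
    by (simp add: q_def sum_nonneg)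
  have zero: "?p (fst z) * q (snd z) = 0"
    if "z \<in> A \<times> B" "?p (fst z) * ?w (fst z) (snd z) = 0" for z
    using that pos[of "fst z" "snd z"] by auto
  have "absolutely_continuous J M"
    unfolding J_point M_point
  proof (rule absolutely_continuousI_point_measure_finite)
    fix z assume "z \<in> A \<times> B" "ennreal (?p (fst z) * ?w (fst z) (snd z)) \<le> 0"
    moreover then have "?p (fst z) * ?w (fst z) (snd z) = 0"
      by (intro antisym) (simp_all add: ennreal_eq_0_iff)
    ultimately show "ennreal (?p (fst z) * q (snd z)) \<le> 0"
      by (simp only: zero)
  qed
  moreover have "integrable M f" for f :: "_ \<Rightarrow> real"
    unfolding M_point by (intro integrable_point_measure_finite) (simp add: fin)
  ultimately show ?wd
    unfolding lautum_well_defined_def J_def[symmetric] M_def[symmetric] by blast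

  have "lautum_information b \<X> \<Y> W P = KL_divergence b J M"
    by (simp add: lautum_information_def J_def M_def)
  also have "\<dots> = (\<Sum>z\<in>A \<times> B. ?p (fst z) * q (snd z)
      * log b (?p (fst z) * q (snd z) / (?p (fst z) * ?w (fst z) (snd z))))"
    unfolding J_point M_point using fin zero
    by (intro KL_divergence_point_measure b) (auto simp: q_nonneg)
  \<comment> \<open>The input mass cancels inside the logarithm. Where it is 0, the outer factor
    makes both summands 0, whatever the value of the logarithm.\<close>
  also have "\<dots> = (\<Sum>z\<in>A \<times> B. ?p (fst z) * q (snd z) * log b (q (snd z) / ?w (fst z) (snd z)))"
    by (intro sum.cong) auto
  finally show ?L
    by (simp add: sum.cartesian_product split_beta)
qed

section \<open>The binary counterexample\<close>

lemma ln_powers_inequality: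
  "444 * ln 2 + 135 * ln 3 < 149 * ln 5 + 69 * ln (23::real)"
proof -
  have "ln ((2::real) ^ 444 * 3 ^ 135) < ln (5 ^ 149 * 23 ^ 69)"
    by (subst ln_less_cancel_iff) simp_all
  then show ?thesis
    \<comment> \<open>The powers have to stay unevaluated for \<open>ln_realpow\<close> to split
      them.\<close>
    by (simp add: ln_mult ln_realpow del: power_numeral)
qed

text \<open>The Bernoulli law with success probability \<open>p\<close>, used both for the inputs
  and for the rows of the channel.\<close>

definition bin_law :: "real \<Rightarrow> real measure" where
  "bin_law p = point_measure {0, 1} (\<lambda>x. ennreal (if x = 0 then 1 - p else p))"

lemma bin_law_in_input_dists:
  assumes "0 \<le> p" "p \<le> 1"
  shows "bin_law p \<in> input_dists (count_space {0, 1})"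
  using assms
  by (auto simp: bin_law_def space_prob_algebra sets_point_measure space_point_measure
      emeasure_point_measure_finite simp flip: ennreal_plus intro!: prob_spaceI)

lemma measure_bin_law:
  assumes "0 \<le> p" "p \<le> 1"
  shows "measure (bin_law p) {0} = 1 - p" "measure (bin_law p) {1} = p"
  using assms by (auto simp: bin_law_def measure_def emeasure_point_measure_finite)

text \<open>Mixing is affine in the parameter, so along these laws concavity in the input becomes
  concavity in a real variable.\<close>

lemma mixture_bin_law:
  assumes "0 \<le> p" "p \<le> 1" "0 \<le> r" "r \<le> 1" "0 \<le> \<alpha>" "\<alpha> \<le> 1"
  shows "mixture \<alpha> (bin_law p) (bin_law r) = bin_law ((1 - \<alpha>) * p + \<alpha> * r)"
proof (rule measure_eqI_finite[of _ "{0, 1}"])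
  fix a :: real assume a: "a \<in> {0, 1}"
  \<comment> \<open>These bounds keep the expanded point masses nonnegative, so that the
    \<open>ennreal\<close> terms can be merged.\<close>
  have le: "\<alpha> * r \<le> \<alpha>" "(1 - \<alpha>) * p \<le> 1 - \<alpha>" "\<alpha> * p \<le> p"
    using assms by (auto intro: mult_left_le mult_left_le_one_le)
  have "emeasure (mixture \<alpha> (bin_law p) (bin_law r)) {a}
        = ennreal (1 - \<alpha>) * emeasure (bin_law p) {a} + ennreal \<alpha> * emeasure (bin_law r) {a}"
    using a by (intro emeasure_mixture) (auto simp: bin_law_def sets_point_measure)
  also have "\<dots> = emeasure (bin_law ((1 - \<alpha>) * p + \<alpha> * r)) {a}"
    using a assms le
    by (auto simp: bin_law_def emeasure_point_measure_finite algebra_simps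
        simp flip: ennreal_plus ennreal_mult)
  finally show "emeasure (mixture \<alpha> (bin_law p) (bin_law r)) {a}
      = emeasure (bin_law ((1 - \<alpha>) * p + \<alpha> * r)) {a}" .
qed (auto simp: bin_law_def sets_point_measure)

theorem theorem1:
  fixes b :: real
  assumes "1 < b"
  shows "\<exists>(\<X> :: real measure) (\<Y> :: real measure). \<exists>W \<in> channels \<X> \<Y>.
           (\<forall>P \<in> input_dists \<X>. lautum_well_defined b \<X> \<Y> W P) \<and>
           \<not> concave_in_input \<X> (lautum_information b \<X> \<Y> W)"
proof -
  define \<X> :: "real measure" where "\<X> = count_space {0, 1}"
  define W :: "real \<Rightarrow> real measure" where "W x = bin_law (if x = 0 then 1/26 else 1/2)" for x
  let ?L = "lautum_information b \<X> \<X> W"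
  have W: "W \<in> channels \<X> \<X>"
    using bin_law_in_input_dists by (auto simp: \<X>_def W_def)
  have W_val: "measure (W 0) {0} = 25/26" "measure (W 0) {1} = 1/26"
      "measure (W 1) {0} = 1/2" "measure (W 1) {1} = 1/2"
    by (simp_all add: W_def measure_bin_law)
  then have pos: "0 < measure (W x) {y}" if "x \<in> {0, 1}" "y \<in> {0, 1}" for x y
    using that by auto
  note lautum = lautum_finite[OF assms _ _ W[unfolded \<X>_def] _ pos, folded \<X>_def, simplified]
  \<comment> \<open>The two recurring brackets are the output masses of 0 and 1; the second equals
    \<open>(1 + 12 * p) / 26\<close>.\<close>
  have L: "?L (bin_law p)
      = (1 - p) * ((1 - p) * 25/26 + p/2) * log b (((1 - p) * 25/26 + p/2) / (25/26))
      + (1 - p) * ((1 - p) / 26 + p/2) * log b (((1 - p) / 26 + p/2) / (1/26))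
      + p * ((1 - p) * 25/26 + p/2) * log b (((1 - p) * 25/26 + p/2) / (1/2))
      + p * ((1 - p) / 26 + p/2) * log b (((1 - p) / 26 + p/2) / (1/2))"
    if "0 \<le> p" "p \<le> 1" for p
    using that bin_law_in_input_dists[OF that]
    by (subst lautum(2)) (simp_all add: \<X>_def W_val measure_bin_law)
  \<comment> \<open>A deterministic input is independent of the output, so the joint law is the
    product law.\<close>
  have "?L (bin_law 0) = 0"
    by (simp add: L)
  have "ln b > 0"
    using assms by simp
  have ln_factors: "ln 12 = 2 * ln 2 + ln (3::real)" "ln 24 = 3 * ln 2 + ln (3::real)"
    "ln 25 = 2 * ln (5::real)" "ln 6 = ln 2 + ln (3::real)"
    "ln 46 = ln 2 + ln (23::real)" "ln 26 = ln 2 + ln (13::real)"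
    using ln_mult[of "2^2" "3::real"] ln_mult[of "2^3" "3::real"] ln_realpow[of "2::real" 2]
      ln_realpow[of "2::real" 3] ln_realpow[of "5::real" 2] ln_mult[of 2 "3::real"]
      ln_mult[of 2 "23::real"] ln_mult[of 2 "13::real"]
    by simp_all
  \<comment> \<open>The factor \<open>ln b\<close> removes the base. At \<open>p = 0\<close>,
    \<open>1/12\<close> and \<open>1/6\<close> the output mass of 1 is 1/26, 2/26 and 3/26, hence
    the simple fractions.\<close>
  have L6: "?L (bin_law (1/6)) * ln b
      = 5/6 * (23/26) * ln (23/25) + 5/6 * (3/26) * ln 3
      + 1/6 * (23/26) * ln (23/13) + 1/6 * (3/26) * ln (3/13)"
    using \<open>ln b > 0\<close> by (subst L) (simp_all add: log_def field_simps)
  have L12: "?L (bin_law (1/12)) * ln b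
      = 11/12 * (12/13) * ln (24/25) + 11/12 * (1/13) * ln 2
      + 1/12 * (12/13) * ln (24/13) + 1/12 * (1/13) * ln (2/13)"
    using \<open>ln b > 0\<close> by (subst L) (simp_all add: log_def field_simps)
  \<comment> \<open>After multiplication by 156, both sides contain \<open>- 13 * ln 13\<close>,
    which cancels; collecting the other primes leaves \<open>ln_powers_inequality\<close>.\<close>
  have "?L (bin_law (1/12)) * ln b < 1/2 * (?L (bin_law (1/6)) * ln b)"
    unfolding L6 L12 using ln_powers_inequality by (simp add: ln_div ln_factors field_simps)
  then have less: "?L (bin_law (1/12)) < 1/2 * ?L (bin_law (1/6))"
    using \<open>ln b > 0\<close> by (metis mult.assoc mult_less_cancel_right_pos)
  have "\<not> concave_in_input \<X> ?L"
  proof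
    assume "concave_in_input \<X> ?L"
    then have "(1 - 1/2) * ?L (bin_law 0) + 1/2 * ?L (bin_law (1/6))
        \<le> ?L (mixture (1/2) (bin_law 0) (bin_law (1/6)))"
      unfolding concave_in_input_def \<X>_def
      by (elim ballE[of _ _ "bin_law 0"] ballE[of _ _ "bin_law (1/6)"] ballE[of _ _ "1/2"])
         (simp_all add: bin_law_in_input_dists)
    \<comment> \<open>The mixture is \<open>bin_law (1/12)\<close>, the midpoint, where the value
      lies strictly below the chord.\<close>
    then show False
      using less \<open>?L (bin_law 0) = 0\<close> by (simp add: mixture_bin_law)
  qed
  with W lautum(1) show ?thesis
    by blast
qed

end
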